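(* Let $m \ge 3$ and $m' \ge 3$ be integers such that $m'-2 = k(m-2)$ for some positive integer $k$. If $n_m = p\,(m-2)^{m-2}$ for a real number $p$, then $n_{m'} \le p\,(m'-2)^{m'-2}$. Equivalently, $\dfrac{n_{m'}}{(m'-2)^{m'-2}} \le \dfrac{n_m}{(m-2)^{m-2}}$.
   Context: For a graph $G$, a $k$-list assignment $L$ assigns to each vertex $v$ a set $L(v)$ of exactly $k$ colors; a proper $L$-coloring chooses $c(v)\in L(v)$ for each $v$ with adjacent vertices receiving different colors. The choice number $ch(G)$ is the least $k$ such that for every $k$-list assignment $L$ of $G$ there is a proper $L$-coloring. $K_{m,n}$ denotes the complete bipartite graph with parts of sizes $m$ and $n$. For an integer $m\ge 3$, $n_m$ denotes the smallest positive integer $n$ such that $ch(K_{m,n}) = m-1$. *)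

theory Defs
  imports Complex_Main "Graph_Theory.Graph_Theory"
begin

text \<open>
  Graphs are the symmetric loop-free digraphs of \<^locale>\<open>graph\<close>; \<open>u \<rightarrow>\<^bsub>G\<^esub> v\<close> is adjacency.
  Colors are natural numbers: a list assignment of a finite graph involves only finitely many
  colors, so any infinite supply of colors gives the same choice number.
\<close>

(* Finiteness is explicit because card is 0 on infinite sets. *)
definition list_assignment :: "('a, 'b) pre_digraph \<Rightarrow> nat \<Rightarrow> ('a \<Rightarrow> nat set) \<Rightarrow> bool" where
  "list_assignment G k L \<longleftrightarrow> (\<forall>v \<in> verts G. finite (L v) \<and> card (L v) = k)"

definition proper_list_coloring ::
    "('a, 'b) pre_digraph \<Rightarrow> ('a \<Rightarrow> nat set) \<Rightarrow> ('a \<Rightarrow> nat) \<Rightarrow> bool" where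
  "proper_list_coloring G L c \<longleftrightarrow>
     (\<forall>v \<in> verts G. c v \<in> L v) \<and> (\<forall>u v. u \<rightarrow>\<^bsub>G\<^esub> v \<longrightarrow> c u \<noteq> c v)"

definition choosable :: "('a, 'b) pre_digraph \<Rightarrow> nat \<Rightarrow> bool" where
  "choosable G k \<longleftrightarrow> (\<forall>L. list_assignment G k L \<longrightarrow> (\<exists>c. proper_list_coloring G L c))"

definition choice_number :: "('a, 'b) pre_digraph \<Rightarrow> nat" where
  "choice_number G = (LEAST k. choosable G k)"

definition complete_bipartite :: "nat \<Rightarrow> nat \<Rightarrow> (nat + nat) pair_pre_digraph" where
  "complete_bipartite m n =
     (let U = Inl ` {..<m}; V = Inr ` {..<n}
      in \<lparr> pverts = U \<union> V, parcs = U \<times> V \<union> V \<times> U \<rparr>)"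

lemma complete_bipartite_digraph_complete_bipartite:
  "complete_bipartite_digraph m n (with_proj (complete_bipartite m n))"
proof -
  have "card (Inl ` {..<m} :: (nat + nat) set) = m" "card (Inr ` {..<n} :: (nat + nat) set) = n"
    by (simp_all add: card_image)
  moreover have "(Inl ` {..<m} :: (nat + nat) set) \<inter> Inr ` {..<n} = {}"
    by blast
  ultimately show ?thesis
    unfolding complete_bipartite_digraph_pair_def complete_bipartite_def Let_def
      pair_pre_digraph.select_convs
    by blast
qed

definition least_part_size :: "nat \<Rightarrow> nat" where
  "least_part_size m =
     (LEAST n. 0 < n \<and> choice_number (with_proj (complete_bipartite m n)) = m - 1)"

end

theory Submission
  imports Defs "HOL-Library.Countable" "HOL-Library.FuncSet"
begin

text \<open>
  Since deleting a vertex lowers the choice number by at most one, \<open>n\<^sub>m\<close> is the least \<open>n\<close> such that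
  \<open>K\<^bsub>m,n\<^esub>\<close> is not \<open>(m - 2)\<close>-choosable.  Failure of \<open>r\<close>-choosability of \<open>K\<^bsub>a,n\<^esub>\<close> means that there are
  \<open>r\<close>-sets \<open>A\<^sub>i\<close> (\<open>i < a\<close>) and at most \<open>n\<close> further \<open>r\<close>-sets, one of which lies inside each
  transversal of the \<open>A\<^sub>i\<close>.  From such a configuration, replace every color by \<open>k\<close> copies and add
  \<open>(k - 1) r\<close> new pairwise disjoint lists of size \<open>k r\<close> on the left; on the right, take every lift of
  an old set joined with every choice from the new lists.  This witnesses that \<open>K\<close> with parts
  \<open>a + (k - 1) r\<close> and \<open>n k\<^sup>r (k r)\<^bsup>(k - 1) r\<^esup>\<close> is not \<open>k r\<close>-choosable, and for \<open>a = r + 2\<close> the left part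
  has size \<open>k r + 2\<close>.
\<close>

section \<open>List colorings of complete bipartite graphs\<close>

lemma verts_complete_bipartite:
  "verts (with_proj (complete_bipartite a n)) = Inl ` {..<a} \<union> Inr ` {..<n}"
  by (simp add: complete_bipartite_def Let_def)

lemma proper_list_coloring_complete_bipartite_iff:
  "proper_list_coloring (with_proj (complete_bipartite a n)) L c \<longleftrightarrow>
     (\<forall>i<a. c (Inl i) \<in> L (Inl i)) \<and> (\<forall>j<n. c (Inr j) \<in> L (Inr j)) \<and>
     (\<forall>i<a. \<forall>j<n. c (Inl i) \<noteq> c (Inr j))"
proof -
  have arc: "u \<rightarrow>\<^bsub>with_proj (complete_bipartite a n)\<^esub> v \<longleftrightarrow>
      (\<exists>i<a. \<exists>j<n. u = Inl i \<and> v = Inr j \<or> u = Inr j \<and> v = Inl i)" for u v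
    by (auto simp: complete_bipartite_def Let_def)
  show ?thesis
    unfolding proper_list_coloring_def arc verts_complete_bipartite
    by (fastforce simp: ball_Un)
qed

lemma list_assignment_complete_bipartite_iff:
  "list_assignment (with_proj (complete_bipartite a n)) r L \<longleftrightarrow>
     (\<forall>i<a. finite (L (Inl i)) \<and> card (L (Inl i)) = r) \<and>
     (\<forall>j<n. finite (L (Inr j)) \<and> card (L (Inr j)) = r)"
  unfolding list_assignment_def verts_complete_bipartite by auto

text \<open>Thinning every list to a \<open>k\<close>-subset reduces to an exact
  \<open>k\<close>-list assignment. This handles lists of unequal sizes, such as those left after
  one color is deleted everywhere.\<close>

lemma choosable_large_lists:
  assumes "choosable G k" and "\<And>v. v \<in> verts G \<Longrightarrow> finite (L v) \<and> k \<le> card (L v)"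
  shows "\<exists>c. proper_list_coloring G L c"
proof -
  have "\<exists>M. \<forall>v\<in>verts G. M v \<subseteq> L v \<and> finite (M v) \<and> card (M v) = k"
    by (rule bchoice) (metis assms(2) obtain_subset_with_card_n)
  then obtain M where M: "\<And>v. v \<in> verts G \<Longrightarrow> M v \<subseteq> L v \<and> finite (M v) \<and> card (M v) = k"
    by blast
  then obtain c where "proper_list_coloring G M c"
    using assms(1) unfolding choosable_def list_assignment_def by blast
  then have "proper_list_coloring G L c"
    using M unfolding proper_list_coloring_def by blast
  then show ?thesis by blast
qed

lemma choosable_mono:
  assumes "choosable G k" and "k \<le> l"
  shows "choosable G l"
  unfolding choosable_def list_assignment_def
  by (intro allI impI choosable_large_lists[OF assms(1)]) (use assms(2) in auto)

text \<open>Reserve a color \<open>x\<close> for the new right vertex and delete it from all other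
  lists: each loses at most one color, and no left vertex can then clash with
  \<open>x\<close>.\<close>

lemma choosable_complete_bipartite_Suc:
  assumes "choosable (with_proj (complete_bipartite a n)) k"
  shows "choosable (with_proj (complete_bipartite a (Suc n))) (Suc k)"
  unfolding choosable_def
proof (intro allI impI)
  fix L :: "nat + nat \<Rightarrow> nat set"
  assume "list_assignment (with_proj (complete_bipartite a (Suc n))) (Suc k) L"
  then have L: "finite (L v) \<and> card (L v) = Suc k" if "v \<in> Inl ` {..<a} \<union> Inr ` {..<Suc n}" for v
    using that unfolding list_assignment_complete_bipartite_iff by blast
  obtain x where x: "x \<in> L (Inr n)"
    using L[of "Inr n"] by fastforce
  have "\<exists>c. proper_list_coloring (with_proj (complete_bipartite a n)) (\<lambda>v. L v - {x}) c"
  proof (rule choosable_large_lists[OF assms])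
    fix v :: "nat + nat"
    assume "v \<in> verts (with_proj (complete_bipartite a n))"
    then have "finite (L v) \<and> card (L v) = Suc k"
      unfolding verts_complete_bipartite by (intro L) auto
    then show "finite (L v - {x}) \<and> k \<le> card (L v - {x})"
      by (auto simp: card_Diff_singleton_if)
  qed
  then obtain c where "proper_list_coloring (with_proj (complete_bipartite a n)) (\<lambda>v. L v - {x}) c" by blast
  with x have "proper_list_coloring (with_proj (complete_bipartite a (Suc n))) L (c(Inr n := x))"
    by (auto simp: proper_list_coloring_complete_bipartite_iff less_Suc_eq)
  then show "\<exists>c. proper_list_coloring (with_proj (complete_bipartite a (Suc n))) L c" by blast
qed

section \<open>Blocking configurations and non-choosability\<close>

definition blocking :: "nat \<Rightarrow> nat \<Rightarrow> (nat \<Rightarrow> 'c set) \<Rightarrow> 'c set set \<Rightarrow> bool" where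
  "blocking a r A S \<longleftrightarrow>
     (\<forall>i<a. finite (A i) \<and> card (A i) = r) \<and> finite S \<and> (\<forall>X\<in>S. finite X \<and> card X = r) \<and>
     (\<forall>f. (\<forall>i<a. f i \<in> A i) \<longrightarrow> (\<exists>X\<in>S. X \<subseteq> f ` {..<a}))"

lemma blockingE:
  assumes "blocking a r A S" and "\<forall>i<a. f i \<in> A i"
  obtains X where "X \<in> S" and "X \<subseteq> f ` {..<a}"
  using assms unfolding blocking_def by meson

text \<open>Transversals pull back along \<open>inv h\<close>, and the blocking set found there is
  pushed forward by \<open>h\<close>. With \<open>to_nat\<close> this turns structured colors back
  into natural numbers.\<close>

lemma blocking_image:
  assumes "blocking a r A S" and "inj h"
  shows "blocking a r (\<lambda>i. h ` A i) ((`) h ` S)"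
proof -
  have "\<exists>X\<in>(`) h ` S. X \<subseteq> f ` {..<a}" if f: "\<forall>i<a. f i \<in> h ` A i" for f
  proof -
    have "\<forall>i<a. (inv h \<circ> f) i \<in> A i"
      using f assms(2) by auto
    with assms(1) obtain X where X: "X \<in> S" "X \<subseteq> (inv h \<circ> f) ` {..<a}"
      by (rule blockingE)
    have "h ((inv h \<circ> f) i) = f i" if "i < a" for i
      using f that by (auto intro!: f_inv_into_f)
    with X have "h ` X \<subseteq> f ` {..<a}"
      by fastforce
    with X(1) show ?thesis by blast
  qed
  moreover have "card (h ` X) = card X" for X
    using assms(2) by (meson card_image inj_on_subset subset_UNIV)
  ultimately show ?thesis
    using assms(1) unfolding blocking_def by auto
qed

text \<open>If a transversal covered no right list, each right vertex could pick a color outside its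
  range, which would complete a proper coloring. Equal right lists merge in \<open>S\<close>, hence
  only \<open>card S \<le> n\<close>.\<close>

lemma blocking_if_not_choosable:
  assumes "\<not> choosable (with_proj (complete_bipartite a n)) r"
  obtains A S where "blocking a r (A :: nat \<Rightarrow> nat set) S" and "card S \<le> n"
proof -
  obtain L where L: "list_assignment (with_proj (complete_bipartite a n)) r L"
    and no: "\<nexists>c. proper_list_coloring (with_proj (complete_bipartite a n)) L c"
    using assms unfolding choosable_def by blast
  define A where "A i = L (Inl i)" for i
  define S where "S = (\<lambda>j. L (Inr j)) ` {..<n}"
  have "\<exists>X\<in>S. X \<subseteq> f ` {..<a}" if f: "\<forall>i<a. f i \<in> A i" for f
  proof (rule ccontr)
    assume "\<not> (\<exists>X\<in>S. X \<subseteq> f ` {..<a})"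
    then have "\<forall>j\<in>{..<n}. \<exists>x. x \<in> L (Inr j) - f ` {..<a}"
      unfolding S_def by blast
    then obtain g where "\<forall>j\<in>{..<n}. g j \<in> L (Inr j) - f ` {..<a}"
      by (rule bchoice[THEN exE])
    with f have "proper_list_coloring (with_proj (complete_bipartite a n)) L (case_sum f g)"
      by (auto simp: proper_list_coloring_complete_bipartite_iff A_def) (metis DiffE imageI lessThan_iff)
    with no show False by blast
  qed
  with L have "blocking a r A S"
    by (auto simp: blocking_def list_assignment_complete_bipartite_iff A_def S_def)
  moreover have "card S \<le> n"
    unfolding S_def using card_image_le[of "{..<n}"] by simp
  ultimately show thesis by (rule that)
qed

text \<open>The left half of a proper coloring would be a transversal covering some list on the
  right, whose vertex must then share its color with a left vertex.\<close>

lemma not_choosable_if_blocking: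
  fixes A :: "nat \<Rightarrow> 'c::countable set"
  assumes "blocking a r A S" and "card S \<le> n"
  shows "\<not> choosable (with_proj (complete_bipartite a n)) r"
proof
  assume ch: "choosable (with_proj (complete_bipartite a n)) r"
  define B where "B i = to_nat ` A i" for i
  define T where "T = (`) to_nat ` S"
  have bl: "blocking a r B T"
    unfolding B_def T_def using assms(1) inj_to_nat by (rule blocking_image)
  have finT: "finite T" and cardT: "card T \<le> n"
    using bl assms card_image_le[of S] unfolding blocking_def T_def by (blast, meson le_trans)
  obtain e where e: "bij_betw e {..<card T} T"
    using ex_bij_betw_nat_finite[OF finT] by (auto simp: atLeast0LessThan)
  \<comment> \<open>Right vertices beyond the \<open>card T\<close> blocking sets get a filler list,
    of size \<open>r\<close> so that \<open>L\<close> is still an \<open>r\<close>-list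
    assignment.\<close>
  define L where "L = case_sum B (\<lambda>j. if j < card T then e j else {..<r})"
  have "e j \<in> T" if "j < card T" for j
    using e that by (auto dest: bij_betwE)
  with bl have "list_assignment (with_proj (complete_bipartite a n)) r L"
    by (auto simp: list_assignment_complete_bipartite_iff L_def blocking_def)
  then obtain c where c: "proper_list_coloring (with_proj (complete_bipartite a n)) L c"
    using ch unfolding choosable_def by blast
  then have "\<forall>i<a. c (Inl i) \<in> B i"
    by (auto simp: proper_list_coloring_complete_bipartite_iff L_def)
  with bl obtain X where X: "X \<in> T" "X \<subseteq> (\<lambda>i. c (Inl i)) ` {..<a}"
    by (rule blockingE)
  have "X \<in> e ` {..<card T}"
    using X(1) bij_betw_imp_surj_on[OF e] by simp
  then obtain j where j: "j < card T" "e j = X"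
    by (elim imageE) simp
  have "j < n"
    using j(1) cardT by simp
  with c have "c (Inr j) \<in> L (Inr j)" and ne: "\<forall>i<a. c (Inl i) \<noteq> c (Inr j)"
    unfolding proper_list_coloring_complete_bipartite_iff by simp_all
  then have "c (Inr j) \<in> (\<lambda>i. c (Inl i)) ` {..<a}"
    using j X(2) by (auto simp: L_def)
  then obtain i where "i < a" "c (Inl i) = c (Inr j)"
    by (elim imageE) simp
  with ne show False by simp
qed

section \<open>The blow-up construction\<close>

lemma blocking_blow_up:
  fixes A :: "nat \<Rightarrow> 'c set"
  assumes bl: "blocking a r A S" and "k > 0"
  obtains A' :: "nat \<Rightarrow> ('c \<times> nat + nat \<times> nat) set" and S'
  where "blocking (a + (k - 1) * r) (k * r) A' S'"
    and "card S' \<le> card S * (k ^ r * (k * r) ^ ((k - 1) * r))"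
proof -
  define b where "b = a + (k - 1) * r"
  define D where "D = {a..<b}"
  have finD [simp]: "finite D" and cardD: "card D = (k - 1) * r"
    by (simp_all add: D_def b_def)
  \<comment> \<open>The tag \<open>i\<close> in the new colors makes the new lists pairwise
    disjoint.\<close>
  define A' :: "nat \<Rightarrow> ('c \<times> nat + nat \<times> nat) set" where
    "A' i = (if i < a then Inl ` (A i \<times> {..<k}) else Inr ` ({i} \<times> {..<k * r}))" for i
  \<comment> \<open>The first factor chooses a copy of each color of \<open>X\<close>, the second a
    color from each new list. Extensional functions make these choices finite in number.\<close>
  define P where
    "P X = (X \<rightarrow>\<^sub>E {..<k}) \<times> (D \<rightarrow>\<^sub>E {..<k * r})" for X :: "'c set"
  \<comment> \<open>Each set has \<open>r\<close> lifted colors and one from each of the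
    \<open>(k - 1) * r\<close> new lists; the number of new lists is chosen to make the total
    \<open>k * r\<close>.\<close>
  define U :: "'c set \<Rightarrow> ('c \<Rightarrow> nat) \<times> (nat \<Rightarrow> nat) \<Rightarrow> ('c \<times> nat + nat \<times> nat) set" where
    "U X q = (\<lambda>x. Inl (x, fst q x)) ` X \<union> (\<lambda>i. Inr (i, snd q i)) ` D" for X q
  define S' where "S' = case_prod U ` Sigma S P"
  have S: "finite S" "\<And>X. X \<in> S \<Longrightarrow> finite X \<and> card X = r"
    using bl unfolding blocking_def by auto
  have P: "finite (P X) \<and> card (P X) = k ^ r * (k * r) ^ ((k - 1) * r)" if "X \<in> S" for X
    using S(2)[OF that]
    by (auto simp: P_def card_cartesian_product card_PiE cardD intro!: finite_PiE)
  have cardU: "finite (U X q) \<and> card (U X q) = k * r" if "X \<in> S" for X q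
  proof -
    have "card (U X q) = card ((\<lambda>x. Inl (x, fst q x) :: 'c \<times> nat + nat \<times> nat) ` X) +
        card ((\<lambda>i. Inr (i, snd q i) :: 'c \<times> nat + nat \<times> nat) ` D)"
      unfolding U_def using S(2)[OF that] by (intro card_Un_disjoint) auto
    also have "\<dots> = r + (k - 1) * r"
      using S(2)[OF that] by (simp add: card_image inj_on_def cardD)
    also have "\<dots> = k * r"
      using \<open>k > 0\<close> by (cases k) auto
    finally show ?thesis
      using S(2)[OF that] by (simp add: U_def)
  qed
  have A': "finite (A' i) \<and> card (A' i) = k * r" for i
    using bl by (auto simp: A'_def blocking_def card_image card_cartesian_product inj_on_def)
  have block: "\<exists>Y\<in>S'. Y \<subseteq> f ` {..<b}" if f: "\<forall>i<b. f i \<in> A' i" for f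
  proof -
    \<comment> \<open>Forgetting copy numbers turns \<open>f\<close> on the old indices into a
      transversal of the lists \<open>A i\<close>; on the new indices \<open>g\<close> records its
      choices.\<close>
    define p where "p i = projl (f i)" for i
    define g where "g = restrict (\<lambda>i. snd (projr (f i))) D"
    have fp: "f i = Inl (p i) \<and> fst (p i) \<in> A i \<and> snd (p i) < k" if "i < a" for i
    proof -
      have "f i \<in> A' i"
        using f that by (simp add: b_def)
      with that show ?thesis
        by (auto simp: A'_def p_def)
    qed
    have fg: "f i = Inr (i, g i) \<and> g i < k * r" if "i \<in> D" for i
    proof -
      have "f i \<in> A' i"
        using f that by (simp add: D_def)
      with that show ?thesis
        by (auto simp: A'_def g_def D_def)
    qed
    have "\<forall>i<a. (fst \<circ> p) i \<in> A i"
      using fp by simp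
    with bl obtain X where X: "X \<in> S" "X \<subseteq> (fst \<circ> p) ` {..<a}"
      by (rule blockingE)
    then have "\<forall>x\<in>X. \<exists>i. i < a \<and> fst (p i) = x"
      by fastforce
    \<comment> \<open>Several old indices may use different copies of the same color
      \<open>x\<close>; \<open>s x\<close> fixes one of them, and its copy number determines the
      lift \<open>t\<close> of \<open>X\<close>.\<close>
    then obtain s where s: "\<forall>x\<in>X. s x < a \<and> fst (p (s x)) = x"
      by (rule bchoice[THEN exE])
    define t where "t = restrict (\<lambda>x. snd (p (s x))) X"
    have "(t, g) \<in> P X"
      using s fp fg by (auto simp: P_def t_def g_def)
    then have "U X (t, g) \<in> S'"
      using X(1) unfolding S'_def by force
    moreover have "Inl (x, t x) \<in> f ` {..<b}" if "x \<in> X" for x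
    proof -
      have "f (s x) = Inl (x, t x)"
        using s fp[of "s x"] that by (metis prod.collapse restrict_apply' t_def)
      moreover have "s x < b"
        using s that by (auto simp: b_def intro: trans_less_add1)
      ultimately show ?thesis
        by (metis image_eqI lessThan_iff)
    qed
    moreover have "Inr (i, g i) \<in> f ` {..<b}" if "i \<in> D" for i
      using fg[OF that] that by (metis D_def atLeastLessThan_iff image_eqI lessThan_iff)
    ultimately show ?thesis
      by (intro bexI[of _ "U X (t, g)"]) (auto simp: U_def)
  qed
  have finSigma: "finite (Sigma S P)"
    using S(1) P by blast
  then have "blocking b (k * r) A' S'"
    using A' cardU block by (auto simp: blocking_def S'_def)
  moreover have "card S' \<le> card S * (k ^ r * (k * r) ^ ((k - 1) * r))"
  proof -
    have "card S' \<le> card (Sigma S P)"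
      unfolding S'_def by (rule card_image_le[OF finSigma])
    also have "\<dots> = (\<Sum>X\<in>S. card (P X))"
      using S(1) P by (intro card_SigmaI) auto
    also have "\<dots> = card S * (k ^ r * (k * r) ^ ((k - 1) * r))"
      using P by simp
    finally show ?thesis .
  qed
  ultimately show thesis
    unfolding b_def by (rule that)
qed

lemma not_choosable_blow_up:
  assumes "\<not> choosable (with_proj (complete_bipartite a n)) r" and "k > 0"
  shows "\<not> choosable (with_proj (complete_bipartite (a + (k - 1) * r)
           (n * (k ^ r * (k * r) ^ ((k - 1) * r))))) (k * r)"
proof -
  obtain A :: "nat \<Rightarrow> nat set" and S where bl: "blocking a r A S" and le: "card S \<le> n"
    using blocking_if_not_choosable[OF assms(1)] .
  obtain A' :: "nat \<Rightarrow> (nat \<times> nat + nat \<times> nat) set" and S'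
    where "blocking (a + (k - 1) * r) (k * r) A' S'"
      and "card S' \<le> card S * (k ^ r * (k * r) ^ ((k - 1) * r))"
    using blocking_blow_up[OF bl assms(2)] .
  with le show ?thesis
    by (meson le_trans mult_le_mono1 not_choosable_if_blocking)
qed

section \<open>The least part size as a threshold for choosability\<close>

text \<open>Blowing up the case of one-element lists by the factor \<open>r\<close> gives lists of
  size \<open>r\<close> and a left part of size \<open>3 + (r - 1) = r + 2\<close>. This supplies
  the witness without which \<open>LEAST\<close> in \<open>least_part_size\<close> would say
  nothing.\<close>

lemma not_choosable_exists:
  assumes "r > 0"
  shows "\<exists>n. \<not> choosable (with_proj (complete_bipartite (r + 2) n)) r"
proof -
  have "blocking 3 1 (\<lambda>_. {0::nat}) {{0}}"
    by (auto simp: blocking_def image_iff intro: exI[of _ 0])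
  then have "\<not> choosable (with_proj (complete_bipartite 3 1)) 1"
    by (rule not_choosable_if_blocking) simp
  from not_choosable_blow_up[OF this assms] assms show ?thesis
    by (metis Suc_diff_1 add.commute add_Suc_right eval_nat_numeral(3) mult.right_neutral add_2_eq_Suc')
qed

lemma choosable_complete_bipartite_0:
  assumes "r > 0"
  shows "choosable (with_proj (complete_bipartite a 0)) r"
  unfolding choosable_def
proof (intro allI impI)
  fix L :: "nat + nat \<Rightarrow> nat set"
  assume L: "list_assignment (with_proj (complete_bipartite a 0)) r L"
  then have "\<forall>i<a. L (Inl i) \<noteq> {}"
    using assms by (auto simp: list_assignment_complete_bipartite_iff)
  then have "proper_list_coloring (with_proj (complete_bipartite a 0)) L (\<lambda>v. SOME x. x \<in> L v)"
    by (auto simp: proper_list_coloring_complete_bipartite_iff some_in_eq)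
  then show "\<exists>c. proper_list_coloring (with_proj (complete_bipartite a 0)) L c" by blast
qed

lemma choice_number_eq_Suc:
  assumes "choosable G (Suc r)" and "\<not> choosable G r"
  shows "choice_number G = Suc r"
  unfolding choice_number_def
  by (intro Least_equality) (use assms choosable_mono not_less_eq_eq in metis)+

text \<open>At the first failing size \<open>l\<close>, the graph with one right vertex fewer is
  still \<open>r\<close>-choosable, so the extra vertex raises the choice number to exactly
  \<open>Suc r\<close>. The empty right part never fails, whence \<open>0 < l\<close>.\<close>

lemma choice_number_least_not_choosable:
  assumes "r > 0" and "\<not> choosable (with_proj (complete_bipartite a n)) r"
  obtains l where "0 < l" and "l \<le> n" and "choice_number (with_proj (complete_bipartite a l)) = Suc r"
proof -
  define l where "l = (LEAST n. \<not> choosable (with_proj (complete_bipartite a n)) r)"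
  have l: "\<not> choosable (with_proj (complete_bipartite a l)) r"
    unfolding l_def using assms(2) by (rule LeastI)
  then have "0 < l"
    using choosable_complete_bipartite_0[OF assms(1)] by (cases l) auto
  then have "choosable (with_proj (complete_bipartite a (l - 1))) r"
    using not_less_Least[of "l - 1" "\<lambda>n. \<not> choosable (with_proj (complete_bipartite a n)) r"]
    by (simp flip: l_def)
  from choosable_complete_bipartite_Suc[OF this] have "choosable (with_proj (complete_bipartite a l)) (Suc r)"
    using \<open>0 < l\<close> by simp
  then have "choice_number (with_proj (complete_bipartite a l)) = Suc r"
    using l by (rule choice_number_eq_Suc)
  moreover have "l \<le> n"
    unfolding l_def using assms(2) by (rule Least_le)
  ultimately show thesis using \<open>0 < l\<close> that by blast
qed

lemma least_part_size_le:
  assumes "r > 0" and "\<not> choosable (with_proj (complete_bipartite (r + 2) n)) r"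
  shows "least_part_size (r + 2) \<le> n"
proof -
  obtain l where "0 < l" "l \<le> n" "choice_number (with_proj (complete_bipartite (r + 2) l)) = Suc r"
    using choice_number_least_not_choosable[OF assms] .
  then have "least_part_size (r + 2) \<le> l"
    unfolding least_part_size_def by (intro Least_le) auto
  with \<open>l \<le> n\<close> show ?thesis by simp
qed

text \<open>Some positive size attains the choice number \<open>r + 1\<close>, so
  \<open>LeastI\<close> shows that \<open>least_part_size\<close> does too; minimality of the choice
  number then excludes \<open>r\<close>.\<close>

lemma not_choosable_least_part_size:
  assumes "r > 0"
  shows "\<not> choosable (with_proj (complete_bipartite (r + 2) (least_part_size (r + 2)))) r"
proof -
  obtain n where "\<not> choosable (with_proj (complete_bipartite (r + 2) n)) r"
    using not_choosable_exists[OF assms] by blast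
  then obtain l where "0 < l" "choice_number (with_proj (complete_bipartite (r + 2) l)) = r + 2 - 1"
    using choice_number_least_not_choosable[OF assms] by (metis add_2_eq_Suc' diff_Suc_1)
  then have "choice_number (with_proj (complete_bipartite (r + 2) (least_part_size (r + 2)))) = r + 2 - 1"
    unfolding least_part_size_def by (metis (mono_tags, lifting) LeastI)
  then show ?thesis
    using not_less_Least[of r "choosable (with_proj (complete_bipartite (r + 2) (least_part_size (r + 2))))"]
    by (simp flip: choice_number_def)
qed

section \<open>Comparison of the two part sizes\<close>

lemma least_part_size_mult_le:
  assumes "r > 0" and "k > 0"
  shows "least_part_size (k * r + 2) * r ^ r \<le> least_part_size (r + 2) * (k * r) ^ (k * r)"
proof -
  define n where "n = least_part_size (r + 2)"
  have kr: "(k - 1) * r + r = k * r"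
    using assms(2) by (cases k) auto
  have "\<not> choosable (with_proj (complete_bipartite (k * r + 2)
      (n * (k ^ r * (k * r) ^ ((k - 1) * r))))) (k * r)"
    using not_choosable_blow_up[OF not_choosable_least_part_size[OF assms(1)] assms(2)] kr
    unfolding n_def by (metis add.assoc add.commute)
  then have "least_part_size (k * r + 2) \<le> n * (k ^ r * (k * r) ^ ((k - 1) * r))"
    using assms by (intro least_part_size_le) auto
  then have "least_part_size (k * r + 2) * r ^ r \<le> n * (k ^ r * (k * r) ^ ((k - 1) * r)) * r ^ r"
    by (rule mult_le_mono1)
  \<comment> \<open>The lift count \<open>k ^ r\<close> absorbs \<open>r ^ r\<close> into
    \<open>(k * r) ^ r\<close>, exactly the factor that completes the exponent
    \<open>(k - 1) * r\<close> to \<open>k * r\<close>.\<close>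
  also have "\<dots> = n * ((k * r) ^ ((k - 1) * r) * (k * r) ^ r)"
    by (simp add: power_mult_distrib)
  also have "\<dots> = n * (k * r) ^ (k * r)"
    by (simp only: power_add[symmetric] kr)
  finally show ?thesis
    unfolding n_def .
qed

theorem theorem1:
  fixes m m' k :: nat
  assumes "m \<ge> 3" and "m' \<ge> 3" and "k > 0" and "m' - 2 = k * (m - 2)"
  shows "(\<forall>p::real. real (least_part_size m) = p * real ((m - 2) ^ (m - 2)) \<longrightarrow>
            real (least_part_size m') \<le> p * real ((m' - 2) ^ (m' - 2)))
       \<and> real (least_part_size m') / real ((m' - 2) ^ (m' - 2))
           \<le> real (least_part_size m) / real ((m - 2) ^ (m - 2))"
proof -
  define r where "r = m - 2"
  have r: "r > 0" "m = r + 2" "m' = k * r + 2"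
    using assms by (auto simp: r_def)
  define R where "R = real ((m - 2) ^ (m - 2))"
  define R' where "R' = real ((m' - 2) ^ (m' - 2))"
  have pos: "R > 0" "R' > 0"
    using assms by (auto simp: R_def R'_def)
  have "least_part_size m' * (m - 2) ^ (m - 2) \<le> least_part_size m * (m' - 2) ^ (m' - 2)"
    using least_part_size_mult_le[OF r(1) assms(3)] r by simp
  then have le: "real (least_part_size m') * R \<le> real (least_part_size m) * R'"
    unfolding R_def R'_def by (metis of_nat_le_iff of_nat_mult)
  have "real (least_part_size m') \<le> p * R'" if "real (least_part_size m) = p * R" for p
  proof -
    have "real (least_part_size m') * R \<le> (p * R') * R"
      using le that by (simp add: mult_ac)
    with pos show ?thesis by simp
  qed
  moreover have "real (least_part_size m') / R' \<le> real (least_part_size m) / R"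
    using le pos by (simp add: field_simps)
  ultimately show ?thesis
    unfolding R_def R'_def by blast
qed

end
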